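(* Let $g\in\mathbb{N}$ and $a\in\mathcal{M}_g$. (1) If $a$ has a double root $\alpha_0\in\mathbb{S}^1$, then there is an isomorphism $$I(a)\cong I\bigl(-\alpha_0(\lambda-\alpha_0)^{-2}\,a\bigr).$$ (2) If $a$ has a double root $\alpha_0\in\mathbb{C}^\times\setminus\mathbb{S}^1$, then $$I(a)=\{\xi_\lambda\in I(a)\mid\xi_{\alpha_0}\neq0\}\cup\{\xi_\lambda\in I(a)\mid\xi_{\alpha_0}=0\}$$ and there is an isomorphism $$\{\xi_\lambda\in I(a)\mid\xi_{\alpha_0}=0\}\cong I\bigl((\lambda-\alpha_0)^{-2}(1-\bar\alpha_0\lambda)^{-2}\,a\bigr).$$
   Context: For $g\in\mathbb{N}_0$ the set of potentials is $$\mathcal{P}_g=\Bigl\{\xi_\lambda=\sum_{d=-1}^{g}\hat\xi_d\lambda^d\ \Big|\ \hat\xi_{-1}\in\begin{pmatrix}0&i\mathbb{R}^+\\0&0\end{pmatrix},\ \mathrm{tr}(\hat\xi_{-1}\hat\xi_0)\neq0,\ \hat\xi_d=-\overline{\hat\xi_{g-1-d}}^{\,t}\in\mathfrak{sl}_2(\mathbb{C})\text{ for }d=-1,\dots,g\Bigr\}.$$ $\mathcal{M}_g=\{a\in\mathbb{C}[\lambda],\ \deg a\le 2g\mid a(0)\neq0,\ \lambda^{2g}\overline{a(1/\bar\lambda)}=a(\lambda),\ \lambda^{-g}a(\lambda)\le0\text{ for }\lambda\in\mathbb{S}^1\}$; this is the set of polynomials $-\lambda\det\xi_\lambda$ with $\xi_\lambda\in\mathcal{P}_g$.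 For a polynomial $a$ of degree $2g$ in $\mathcal{M}_g$, the isospectral set is $I(a)=\{\xi_\lambda\in\mathcal{P}_g\mid-\lambda\det\xi_\lambda=a(\lambda)\}$ (so the polynomials of degree $2g-2$ and $2g-4$ on the right hand sides have isospectral sets in $\mathcal{P}_{g-1}$ and $\mathcal{P}_{g-2}$). Isospectral sets are subsets of finite dimensional real vector spaces; "isomorphism" is meant as a diffeomorphism, i.e. a bijection smooth in both directions as a map between such subsets. *)

theory Defs
  imports "HOL-Analysis.Analysis" "HOL-Computational_Algebra.Computational_Algebra"
begin

text \<open>
  A Laurent polynomial with coefficients in the complex 2 by 2 matrices is represented by its
  coefficient family, indexed by the integers.  The type of bounded families (every function on
  the discrete space of integers is continuous) serves as a common ambient normed space for
  the potentials of all degrees; those of a fixed degree lie in the finite-dimensional subspace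
  of families supported on \<open>{-1..g}\<close>.
\<close>

type_synonym laurent_matrix = "int \<Rightarrow>\<^sub>C (complex^2^2)"

definition conj_transpose :: "complex^'n^'m \<Rightarrow> complex^'m^'n"
  where "conj_transpose A = transpose (map_matrix cnj A)"

definition potentials :: "nat \<Rightarrow> laurent_matrix set"
  where "potentials g =
    {\<xi> :: laurent_matrix. (\<forall>d. d \<notin> {-1..int g} \<longrightarrow> \<xi> d = 0) \<and>
         (\<exists>r::real. 0 < r \<and> \<xi> (-1) = vector [vector [0, \<i> * of_real r], vector [0, 0]]) \<and>
         trace (\<xi> (-1) ** \<xi> 0) \<noteq> 0 \<and>
         (\<forall>d\<in>{-1..int g}. trace (\<xi> d) = 0 \<and>
            \<xi> d = - conj_transpose (\<xi> (int g - 1 - d)))}"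

text \<open>The value at a nonzero complex number of a Laurent polynomial supported on \<open>{-1..g}\<close>.\<close>

definition laurent_eval :: "nat \<Rightarrow> laurent_matrix \<Rightarrow> complex \<Rightarrow> complex^2^2"
  where "laurent_eval g \<xi> z = (\<Sum>d = -1..int g. map_matrix ((*) (z powi d)) (\<xi> d))"

definition spectral_polys :: "nat \<Rightarrow> complex poly set"
  where "spectral_polys g =
    {a. degree a \<le> 2 * g \<and> poly a 0 \<noteq> 0 \<and>
        (\<forall>z. z \<noteq> 0 \<longrightarrow> z ^ (2 * g) * cnj (poly a (1 / cnj z)) = poly a z) \<and>
        (\<forall>z. norm z = 1 \<longrightarrow> z powi (- int g) * poly a z \<in> \<real>\<^sub>\<le>\<^sub>0)}"

definition isospectral :: "nat \<Rightarrow> complex poly \<Rightarrow> laurent_matrix set"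
  where "isospectral g a =
    {\<xi> \<in> potentials g. \<forall>z. z \<noteq> 0 \<longrightarrow> - z * det (laurent_eval g \<xi> z) = poly a z}"

primrec Ck_on :: "nat \<Rightarrow> 'a::real_normed_vector set \<Rightarrow> ('a \<Rightarrow> 'b::real_normed_vector) \<Rightarrow> bool"
  where
    "Ck_on 0 U f \<longleftrightarrow> continuous_on U f"
  | "Ck_on (Suc k) U f \<longleftrightarrow> (\<forall>x\<in>U. f differentiable (at x)) \<and>
       (\<forall>v. Ck_on k U (\<lambda>x. frechet_derivative f (at x) v))"

text \<open>
  Smoothness on an arbitrary subset: locally, the map is the restriction of a smooth map on an
  open set.  If \<open>X\<close> lies in a finite-dimensional subspace \<open>V\<close>, it makes no difference whether open
  subsets of \<open>V\<close> or of the ambient space are used: restrict to \<open>V\<close>, or precompose with a continuous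
  linear projection onto \<open>V\<close>.  Likewise for targets in a finite-dimensional subspace.
\<close>

definition smooth_map_on :: "'a::real_normed_vector set \<Rightarrow> ('a \<Rightarrow> 'b::real_normed_vector) \<Rightarrow> bool"
  where "smooth_map_on X f \<longleftrightarrow>
    (\<forall>x\<in>X. \<exists>U F. open U \<and> x \<in> U \<and> (\<forall>k. Ck_on k U F) \<and> (\<forall>y\<in>X \<inter> U. F y = f y))"

definition diffeomorphic :: "'a::real_normed_vector set \<Rightarrow> 'b::real_normed_vector set \<Rightarrow> bool"
  where "diffeomorphic X Y \<longleftrightarrow>
    (\<exists>f. bij_betw f X Y \<and> smooth_map_on X f \<and> smooth_map_on Y (the_inv_into X f))"

text \<open>Multiplicity at least two; roots of higher order are included.\<close>

definition double_root :: "complex poly \<Rightarrow> complex \<Rightarrow> bool"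
  where "double_root a \<alpha> \<longleftrightarrow> 2 \<le> order \<alpha> a"

end

theory Submission
  imports Defs "HOL-Computational_Algebra.Field_as_Ring"
begin

text \<open>
  Let \<open>p\<close> be a polynomial of degree \<open>m\<close> that equals its own conjugate reflection
  \<open>\<lambda>^m cnj (p (1 / cnj \<lambda>))\<close>.  Multiplication by \<open>p\<close> preserves the reality condition while
  raising the genus by \<open>m\<close>, and multiplies the determinant by \<open>p^2\<close>; the phase that it introduces in
  \<open>\<xi>\<close> at degree -1 is undone by conjugation with a constant diagonal unitary matrix.  This identifies
  the isospectral set of \<open>b\<close> with the potentials of \<open>p^2 b\<close> all of whose entries are divisible
  by \<open>p\<close>, and both directions are restrictions of bounded linear maps.  On the unit circle take
  \<open>p = c (\<lambda> - \<alpha>)\<close> with \<open>c^2 = - cnj \<alpha>\<close>, where divisibility is automatic;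
  off the circle take \<open>p = (\<lambda> - \<alpha>) (1 - cnj \<alpha> \<lambda>)\<close>.
\<close>

section \<open>Smoothness of bounded linear maps\<close>

lemma Ck_on_const: "Ck_on k U (\<lambda>x. c)"
  by (induction k arbitrary: c) simp_all

text \<open>A bounded linear map is its own derivative at every point, so each directional
  derivative is a constant function.\<close>

lemma Ck_on_bounded_linear:
  assumes "bounded_linear f"
  shows "Ck_on k U f"
proof (cases k)
  case 0
  then show ?thesis using assms by (simp add: linear_continuous_on)
next
  case (Suc k')
  have D: "(f has_derivative f) (at x)" for x
    by (rule bounded_linear_imp_has_derivative[OF assms])
  have "frechet_derivative f (at x) = f" for x
    using frechet_derivative_at[OF D] by simp
  then show ?thesis
    using D Suc by (auto simp: Ck_on_const differentiable_def)
qed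

lemma smooth_map_on_bounded_linear:
  assumes "bounded_linear F" "\<And>x. x \<in> X \<Longrightarrow> F x = f x"
  shows "smooth_map_on X f"
  unfolding smooth_map_on_def
  using assms by (metis Ck_on_bounded_linear IntD1 UNIV_I open_UNIV)

text \<open>\<open>F\<close> and \<open>G\<close> are mutually inverse only between \<open>X\<close>
  and \<open>Y\<close>. On \<open>Y\<close> the map \<open>G\<close> agrees with
  \<open>the_inv_into X F\<close> and so serves as its smooth extension.\<close>

lemma diffeomorphic_bounded_linear:
  assumes "bounded_linear F" "bounded_linear G"
    and FX: "\<And>x. x \<in> X \<Longrightarrow> F x \<in> Y" and GY: "\<And>y. y \<in> Y \<Longrightarrow> G y \<in> X"
    and GF: "\<And>x. x \<in> X \<Longrightarrow> G (F x) = x" and FG: "\<And>y. y \<in> Y \<Longrightarrow> F (G y) = y"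
  shows "diffeomorphic X Y"
  unfolding diffeomorphic_def
proof (intro exI conjI)
  show "bij_betw F X Y"
    by (rule bij_betw_byWitness[where f' = G]) (use FX GY GF FG in auto)
  then have inj: "inj_on F X" by (rule bij_betw_imp_inj_on)
  show "smooth_map_on X F"
    by (rule smooth_map_on_bounded_linear[OF assms(1)]) simp
  show "smooth_map_on Y (the_inv_into X F)"
    by (rule smooth_map_on_bounded_linear[OF assms(2)])
      (metis FG GY inj the_inv_into_f_f)
qed

section \<open>Conjugate reflection of polynomials\<close>

lemma poly_eqI_nonzero:
  fixes p q :: "'a::{field_char_0} poly"
  assumes "\<And>z. z \<noteq> 0 \<Longrightarrow> poly p z = poly q z"
  shows "p = q"
proof -
  \<comment> \<open>The extra factor \<lambda> makes both sides agree at 0 as well.\<close>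
  have "poly (pCons 0 p) z = poly (pCons 0 q) z" for z
    using assms[of z] by (cases "z = 0") auto
  then have "pCons 0 p = pCons 0 q" by (metis poly_eq_poly_eq_iff ext)
  then show ?thesis by simp
qed

text \<open>The order \<open>n\<close> is a formal degree: the reality condition pairs coefficients
  \<open>k\<close> and \<open>n - k\<close> even when the top one vanishes.\<close>

definition conj_reflect :: "nat \<Rightarrow> complex poly \<Rightarrow> complex poly"
  where "conj_reflect n p = (\<Sum>k\<le>n. monom (cnj (coeff p (n - k))) k)"

lemma coeff_conj_reflect: "coeff (conj_reflect n p) k = (if k \<le> n then cnj (coeff p (n - k)) else 0)"
  by (auto simp: conj_reflect_def coeff_sum)

lemma poly_conj_reflect:
  assumes "degree p \<le> n" "z \<noteq> 0"
  shows "poly (conj_reflect n p) z = z ^ n * cnj (poly p (1 / cnj z))"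
proof -
  have "poly (conj_reflect n p) z = (\<Sum>k\<le>n. cnj (coeff p (n - k)) * z ^ k)"
    by (simp add: conj_reflect_def poly_sum poly_monom)
  also have "\<dots> = (\<Sum>k\<le>n. cnj (coeff p k) * z ^ (n - k))"
    by (rule sum.reindex_bij_witness[where i = "\<lambda>k. n - k" and j = "\<lambda>k. n - k"]) auto
  also have "\<dots> = (\<Sum>k\<le>n. z ^ n * (cnj (coeff p k) * (1 / z) ^ k))"
    by (rule sum.cong) (use assms(2) in \<open>auto simp: power_diff power_divide\<close>)
  also have "\<dots> = z ^ n * cnj (\<Sum>k\<le>n. coeff p k * (1 / cnj z) ^ k)"
    by (simp add: sum_distrib_left)
  also have "(\<Sum>k\<le>n. coeff p k * (1 / cnj z) ^ k) = poly p (1 / cnj z)"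
    using arg_cong[OF poly_as_sum_of_monoms'[OF assms(1)], of "\<lambda>q. poly q (1 / cnj z)"]
    by (simp add: poly_sum poly_monom)
  finally show ?thesis .
qed

text \<open>At a nonzero point, reflection is a power of the point times a conjugated value, and
  both factors are multiplicative.\<close>

lemma conj_reflect_mult:
  assumes "degree p \<le> m" "degree q \<le> n"
  shows "conj_reflect (m + n) (p * q) = conj_reflect m p * conj_reflect n q"
proof (rule poly_eqI_nonzero)
  fix z :: complex assume z: "z \<noteq> 0"
  have "degree (p * q) \<le> m + n"
    using assms degree_mult_le[of p q] by linarith
  then show "poly (conj_reflect (m + n) (p * q)) z = poly (conj_reflect m p * conj_reflect n q) z"
    using assms z by (simp add: poly_conj_reflect power_add)
qed

lemma conj_reflect_smult: "conj_reflect n (smult c p) = smult (cnj c) (conj_reflect n p)"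
  by (rule poly_eqI) (simp add: coeff_conj_reflect)

lemma conj_reflect_linear: "conj_reflect 1 [:u, v:] = [:cnj v, cnj u:]"
  by (simp add: conj_reflect_def atMost_Suc monom_altdef)

section \<open>Laurent families as matrices of polynomials\<close>

text \<open>Entries of \<open>\<lambda> \<xi>\<^sub>\<lambda>\<close>: the extra factor \<open>\<lambda>\<close> clears the pole, so
  degrees are shifted by one.\<close>

definition entry :: "nat \<Rightarrow> laurent_matrix \<Rightarrow> 2 \<Rightarrow> 2 \<Rightarrow> complex poly"
  where "entry g \<xi> i j = (\<Sum>n<g + 2. monom (\<xi> (int n - 1) $ i $ j) n)"

text \<open>Inverse to \<open>entry g\<close> on families supported in \<open>{-1..g}\<close>.
  Without the test \<open>d < -1\<close>, \<open>nat\<close> would send those indices to coefficient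
  0.\<close>

definition family :: "(2 \<Rightarrow> 2 \<Rightarrow> complex poly) \<Rightarrow> laurent_matrix"
  where "family P =
    Bcontfun (\<lambda>d. \<chi> i j. if d < -1 then 0 else coeff (P i j) (nat (d + 1)))"

text \<open>\<open>Bcontfun\<close> is meaningful only on bounded functions. Past a common degree
  bound all coefficients vanish, so the range is finite.\<close>

lemma apply_family:
  "family P d = (\<chi> i j. if d < -1 then 0 else coeff (P i j) (nat (d + 1)))"
proof -
  let ?f = "\<lambda>d::int. (\<chi> i j. if d < -1 then 0 else coeff (P i j) (nat (d + 1))) :: complex^2^2"
  define N where "N = (\<Sum>i\<in>UNIV. \<Sum>j\<in>UNIV. degree (P i j))"
  have le: "degree (P i j) \<le> N" for i j
  proof -
    have "degree (P i j) \<le> (\<Sum>j\<in>UNIV. degree (P i j))"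
      by (rule member_le_sum) auto
    also have "\<dots> \<le> N"
      unfolding N_def by (rule member_le_sum) auto
    finally show ?thesis .
  qed
  have "range ?f \<subseteq> insert 0 (?f ` {-1..int N})"
  proof
    fix A assume "A \<in> range ?f"
    then obtain d where d: "A = ?f d" by blast
    show "A \<in> insert 0 (?f ` {-1..int N})"
    proof (cases "d \<in> {-1..int N}")
      case False
      then have "A = 0"
        unfolding d vec_eq_iff using le by (auto intro!: coeff_eq_0 le_less_trans[OF le])
      then show ?thesis by simp
    qed (use d in blast)
  qed
  then have "finite (range ?f)"
    by (rule finite_subset) simp
  then have "?f \<in> bcontfun"
    by (simp add: bcontfun_def finite_imp_bounded continuous_on_discrete)
  then show ?thesis
    by (simp add: family_def Bcontfun_inverse)
qed

lemma family_add: "family (\<lambda>i j. P i j + Q i j) = family P + family Q"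
  by (rule bcontfun_eqI) (simp add: apply_family vec_eq_iff)

lemma family_scaleR:
  "family (\<lambda>i j. smult (of_real r) (P i j)) = r *\<^sub>R family P"
  by (rule bcontfun_eqI) (simp add: apply_family vec_eq_iff scaleR_conv_of_real[where 'a = complex])

lemma family_0: "family (\<lambda>i j. 0) = 0"
  by (rule bcontfun_eqI) (simp add: apply_family vec_eq_iff)

lemma coeff_entry:
  "coeff (entry g \<xi> i j) n = (if n < g + 2 then \<xi> (int n - 1) $ i $ j else 0)"
  by (auto simp: entry_def coeff_sum)

lemma degree_entry_le: "degree (entry g \<xi> i j) \<le> g + 1"
  by (rule degree_le) (auto simp: coeff_entry)

lemma entry_family:
  assumes "\<And>i j. degree (P i j) \<le> g + 1"
  shows "entry g (family P) i j = P i j"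
proof (rule poly_eqI)
  fix n
  show "coeff (entry g (family P) i j) n = coeff (P i j) n"
    using assms[of i j] by (cases "n < g + 2") (simp_all add: coeff_entry apply_family coeff_eq_0)
qed

lemma family_supported:
  assumes "\<And>i j. degree (P i j) \<le> g + 1" "d \<notin> {-1..int g}"
  shows "family P d = 0"
  using assms(2)
  by (auto simp: apply_family vec_eq_iff intro!: coeff_eq_0 le_less_trans[OF assms(1)])

lemma family_entry:
  fixes \<xi> :: laurent_matrix
  assumes "\<And>d. d \<notin> {-1..int g} \<Longrightarrow> \<xi> d = 0"
  shows "family (entry g \<xi>) = \<xi>"
proof (rule bcontfun_eqI)
  fix d :: int
  show "family (entry g \<xi>) d = \<xi> d"
    using assms[of d] by (cases "d \<in> {-1..int g}") (auto simp: apply_family vec_eq_iff coeff_entry)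
qed

section \<open>Bounded linearity of entrywise operations\<close>

lemma bounded_linear_apply_bcontfun:
  fixes x :: "'a::topological_space"
  shows "bounded_linear (\<lambda>f :: 'a \<Rightarrow>\<^sub>C 'b::real_normed_vector. f x)"
  by (rule bounded_linear_intro[where K = 1]) (simp_all add: norm_bounded)

text \<open>Only finitely many coefficients enter \<open>entry g\<close>. Each contributes a bounded
  evaluation followed by a linear map out of the finite-dimensional matrix space; the induction adds
  up these contributions.\<close>

lemma bounded_linear_family_entry:
  assumes add: "\<And>i j p q. L i j (p + q) = L i j p + L i j q"
    and smult: "\<And>i j c p. L i j (smult c p) = smult c (L i j p)"
  shows "bounded_linear (\<lambda>\<xi>. family (\<lambda>i j. L i j (entry g \<xi> i j)))"
proof -
  have L0: "L i j 0 = 0" for i j using smult[of i j 0 0] by simp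
  have "bounded_linear (\<lambda>\<xi>::laurent_matrix.
      family (\<lambda>i j. L i j (\<Sum>n<N. monom (\<xi> (int n - 1) $ i $ j) n)))" for N
  proof (induction N)
    case 0
    then show ?case by (simp add: L0 family_0 bounded_linear_zero)
  next
    case (Suc N)
    have "linear (\<lambda>A::complex^2^2. family (\<lambda>i j. L i j (monom (A $ i $ j) N)))"
      by (rule linearI)
        (simp_all add: add_monom[symmetric] add family_add scaleR_conv_of_real[where 'a = complex]
          smult_monom[symmetric] smult family_scaleR[symmetric])
    then have "bounded_linear (\<lambda>A::complex^2^2. family (\<lambda>i j. L i j (monom (A $ i $ j) N)))"
      by (simp add: linear_conv_bounded_linear)
    from bounded_linear_compose[OF this bounded_linear_apply_bcontfun[of "int N - 1"]]
    show ?case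
      by (simp add: add family_add bounded_linear_add[OF Suc.IH])
  qed
  then show ?thesis unfolding entry_def .
qed

section \<open>Potentials and isospectral sets through entry polynomials\<close>

lemma poly_entry:
  assumes "z \<noteq> 0"
  shows "poly (entry g \<xi> i j) z = z * laurent_eval g \<xi> z $ i $ j"
proof -
  have "z * laurent_eval g \<xi> z $ i $ j = (\<Sum>d = -1..int g. z powi (d + 1) * \<xi> d $ i $ j)"
    using assms
    by (simp add: laurent_eval_def map_matrix_def sum_distrib_left power_int_add mult_ac)
  also have "\<dots> = (\<Sum>n<g + 2. z ^ n * \<xi> (int n - 1) $ i $ j)"
    by (rule sum.reindex_bij_witness[where i = "\<lambda>n. int n - 1" and j = "\<lambda>d. nat (d + 1)"])
      (auto simp: power_int_def)
  also have "\<dots> = poly (entry g \<xi> i j) z"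
    by (simp add: entry_def poly_sum poly_monom mult_ac)
  finally show ?thesis by simp
qed

text \<open>After the shift by one, the pairing of degrees d and g - 1 - d becomes reflection of
  order g + 1. The only nonzero entry of \<xi> at degree -1 is i r at (1,2), so the trace condition
  says that the (2,1) entry at degree 0, which is coefficient 1 of \<open>P 2 1\<close>, is
  nonzero.\<close>

definition potential_poly :: "nat \<Rightarrow> (2 \<Rightarrow> 2 \<Rightarrow> complex poly) \<Rightarrow> bool"
  where "potential_poly g P \<longleftrightarrow>
    (\<forall>i j. degree (P i j) \<le> g + 1) \<and> P 2 2 = - P 1 1 \<and>
    (\<forall>i j. conj_reflect (g + 1) (P i j) = - P j i) \<and>
    coeff (P 1 1) 0 = 0 \<and> coeff (P 2 1) 0 = 0 \<and>
    (\<exists>r>0. coeff (P 1 2) 0 = \<i> * of_real r) \<and> coeff (P 2 1) 1 \<noteq> 0"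

lemma potential_poly_degree: "potential_poly g P \<Longrightarrow> degree (P i j) \<le> g + 1"
  by (simp add: potential_poly_def)

lemma potentials_iff:
  "\<xi> \<in> potentials g \<longleftrightarrow>
    (\<forall>d. d \<notin> {-1..int g} \<longrightarrow> \<xi> d = 0) \<and> potential_poly g (entry g \<xi>)"
proof -
  have tr: "(\<forall>d\<in>{-1..int g}. trace (\<xi> d) = 0) \<longleftrightarrow> entry g \<xi> 2 2 = - entry g \<xi> 1 1"
  proof
    assume *: "\<forall>d\<in>{-1..int g}. trace (\<xi> d) = 0"
    show "entry g \<xi> 2 2 = - entry g \<xi> 1 1"
    proof (rule poly_eqI)
      fix n
      show "coeff (entry g \<xi> 2 2) n = coeff (- entry g \<xi> 1 1) n"
        using *[rule_format, of "int n - 1"]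
        by (auto simp: coeff_entry trace_def sum_2 add_eq_0_iff)
    qed
  next
    assume *: "entry g \<xi> 2 2 = - entry g \<xi> 1 1"
    show "\<forall>d\<in>{-1..int g}. trace (\<xi> d) = 0"
    proof
      fix d assume d: "d \<in> {-1..int g}"
      have "coeff (entry g \<xi> 2 2) (nat (d + 1)) = - coeff (entry g \<xi> 1 1) (nat (d + 1))"
        by (simp add: *)
      then show "trace (\<xi> d) = 0"
        using d by (simp add: coeff_entry trace_def sum_2 split: if_splits)
    qed
  qed
  have st: "(\<forall>d\<in>{-1..int g}. \<xi> d = - conj_transpose (\<xi> (int g - 1 - d))) \<longleftrightarrow>
      (\<forall>i j. conj_reflect (g + 1) (entry g \<xi> i j) = - entry g \<xi> j i)"
  proof
    assume *: "\<forall>d\<in>{-1..int g}. \<xi> d = - conj_transpose (\<xi> (int g - 1 - d))"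
    show "\<forall>i j. conj_reflect (g + 1) (entry g \<xi> i j) = - entry g \<xi> j i"
    proof (intro allI poly_eqI)
      fix i j n
      show "coeff (conj_reflect (g + 1) (entry g \<xi> i j)) n = coeff (- entry g \<xi> j i) n"
      proof (cases "n \<le> g + 1")
        case True
        \<comment> \<open>The partner degree is kept as \<open>int (g + 1 - n) - 1\<close>, the form
          in which \<open>coeff_entry\<close> delivers it.\<close>
        then have "\<xi> (int n - 1) = - conj_transpose (\<xi> (int (g + 1 - n) - 1))"
          using *[rule_format, of "int n - 1"] by (simp add: of_nat_diff algebra_simps)
        then have "\<xi> (int n - 1) $ j $ i = - cnj (\<xi> (int (g + 1 - n) - 1) $ i $ j)"
          by (simp add: conj_transpose_def transpose_def map_matrix_def)
        then show ?thesis
          using True by (simp add: coeff_conj_reflect coeff_entry del: of_nat_diff)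
      qed (simp add: coeff_conj_reflect coeff_entry)
    qed
  next
    assume *: "\<forall>i j. conj_reflect (g + 1) (entry g \<xi> i j) = - entry g \<xi> j i"
    show "\<forall>d\<in>{-1..int g}. \<xi> d = - conj_transpose (\<xi> (int g - 1 - d))"
    proof
      fix d assume "d \<in> {-1..int g}"
      then obtain n where n: "d = int n - 1" "n \<le> g + 1"
        by (intro that[of "nat (d + 1)"]) auto
      have "\<xi> d $ j $ i = - cnj (\<xi> (int g - 1 - d) $ i $ j)" for i j
      proof -
        have "coeff (conj_reflect (g + 1) (entry g \<xi> i j)) n = - coeff (entry g \<xi> j i) n"
          by (simp only: *[rule_format] coeff_minus)
        then have "cnj (\<xi> (int (g + 1 - n) - 1) $ i $ j) = - \<xi> d $ j $ i"
          using n by (simp add: coeff_conj_reflect coeff_entry less_Suc_eq_le del: of_nat_diff)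
        moreover have "int (g + 1 - n) - 1 = int g - 1 - d"
          using n by simp
        ultimately show ?thesis by (metis minus_minus)
      qed
      then show "\<xi> d = - conj_transpose (\<xi> (int g - 1 - d))"
        by (simp add: conj_transpose_def transpose_def map_matrix_def vec_eq_iff)
    qed
  qed
  \<comment> \<open>\<open>potential_poly\<close> does not list the (2,2) entry at degree -1; its
    vanishing comes from tracelessness.\<close>
  have init: "(\<exists>r>0. \<xi> (-1) = vector [vector [0, \<i> * of_real r], vector [0, 0]]) \<and>
        trace (\<xi> (-1) ** \<xi> 0) \<noteq> 0 \<longleftrightarrow>
      coeff (entry g \<xi> 1 1) 0 = 0 \<and> coeff (entry g \<xi> 2 1) 0 = 0 \<and>
      (\<exists>r>0. coeff (entry g \<xi> 1 2) 0 = \<i> * of_real r) \<and> coeff (entry g \<xi> 2 1) 1 \<noteq> 0"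
    if "entry g \<xi> 2 2 = - entry g \<xi> 1 1"
  proof -
    have "coeff (entry g \<xi> 2 2) 0 = - coeff (entry g \<xi> 1 1) 0"
      by (simp add: that)
    then have "\<xi> (-1) $ 2 $ 2 = - \<xi> (-1) $ 1 $ 1"
      by (simp add: coeff_entry)
    then show ?thesis
      by (auto simp: coeff_entry vec_eq_iff forall_2 vector_2 trace_def sum_2 matrix_matrix_mult_def)
  qed
  show ?thesis
    unfolding potentials_def potential_poly_def mem_Collect_eq ball_conj_distrib tr st
    using init degree_entry_le by blast
qed

text \<open>Each entry carries a factor \<lambda>, so minus the determinant of the entry matrix is
  \<lambda> times (-\<lambda> det \<xi>), hence \<lambda> a, which is
  \<open>pCons 0 a\<close>.\<close>

lemma isospectral_iff:
  "\<xi> \<in> isospectral g a \<longleftrightarrow>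
    (\<forall>d. d \<notin> {-1..int g} \<longrightarrow> \<xi> d = 0) \<and> potential_poly g (entry g \<xi>) \<and>
    entry g \<xi> 1 2 * entry g \<xi> 2 1 - entry g \<xi> 1 1 * entry g \<xi> 2 2 = pCons 0 a"
proof -
  let ?P = "entry g \<xi>"
  let ?D = "?P 1 2 * ?P 2 1 - ?P 1 1 * ?P 2 2"
  have ev: "poly ?D z = z * (- z * det (laurent_eval g \<xi> z))" if "z \<noteq> 0" for z
    using that by (simp add: poly_entry det_2 algebra_simps)
  have "(\<forall>z. z \<noteq> 0 \<longrightarrow> - z * det (laurent_eval g \<xi> z) = poly a z) \<longleftrightarrow> ?D = pCons 0 a"
  proof
    assume "\<forall>z. z \<noteq> 0 \<longrightarrow> - z * det (laurent_eval g \<xi> z) = poly a z"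
    then show "?D = pCons 0 a"
      by (intro poly_eqI_nonzero) (simp add: ev del: poly_diff poly_mult)
  next
    assume D: "?D = pCons 0 a"
    show "\<forall>z. z \<noteq> 0 \<longrightarrow> - z * det (laurent_eval g \<xi> z) = poly a z"
    proof (intro allI impI)
      fix z :: complex assume z: "z \<noteq> 0"
      have "z * (- z * det (laurent_eval g \<xi> z)) = z * poly a z"
        using ev[OF z] unfolding D by simp
      then show "- z * det (laurent_eval g \<xi> z) = poly a z"
        using z mult_left_cancel by blast
    qed
  qed
  then show ?thesis
    by (auto simp: isospectral_def potentials_iff)
qed


section \<open>Multiplication by a self-reflected polynomial\<close>

text \<open>Conjugation by \<open>diag (v, cnj v)\<close> with \<open>v^2 = w\<close> and \<open>norm v = 1\<close> multiplies the entry
  at \<open>(i, j)\<close> by \<open>rot w i j\<close>.\<close>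

definition rot :: "complex \<Rightarrow> 2 \<Rightarrow> 2 \<Rightarrow> complex"
  where "rot w i j = (if i = j then 1 else if i = 1 then w else cnj w)"

lemma rot_inverse:
  assumes "norm w = 1"
  shows "rot w i j * rot (cnj w) i j = 1" "rot (cnj w) i j * rot w i j = 1" "rot w i j \<noteq> 0"
proof -
  have "w * cnj w = 1" "cnj w * w = 1" "w \<noteq> 0"
    using assms complex_norm_square[of w] by (auto simp: mult.commute)
  then show "rot w i j * rot (cnj w) i j = 1" "rot (cnj w) i j * rot w i j = 1" "rot w i j \<noteq> 0"
    by (auto simp: rot_def)
qed

lemma cnj_rot: "cnj (rot w i j) = rot w j i"
  using exhaust_2[of i] exhaust_2[of j] by (auto simp: rot_def)

lemma smult_mult_left_cancel:
  fixes p :: "'a::idom poly"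
  assumes "r \<noteq> 0" "p \<noteq> 0"
  shows "smult r (p * x) = smult r (p * y) \<longleftrightarrow> x = y"
  using assms by (metis mult_left_cancel mult_smult_left smult_eq_0_iff)

text \<open>The conditions pass both ways because \<open>p\<close> is nonzero and self-reflected and
  \<open>w\<close> is unimodular. By \<open>wp\<close> the phase \<open>w\<close> makes p(0)
  positive, so the (1,2) entry at degree -1 is rescaled by \<open>c > 0\<close>. The equivalence
  serves multiplication and division by \<open>p\<close> alike.\<close>

lemma potential_poly_mult:
  fixes p :: "complex poly"
  assumes p: "degree p = m" "conj_reflect m p = p" and w: "norm w = 1"
    and wp: "w * coeff p 0 = of_real c" "0 < c"
  shows "potential_poly (n + m) (\<lambda>i j. smult (rot w i j) (p * Q i j)) \<longleftrightarrow> potential_poly n Q"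
proof -
  define P where "P = (\<lambda>i j. smult (rot w i j) (p * Q i j))"
  have p0: "p \<noteq> 0" "coeff p 0 \<noteq> 0" using wp by auto
  have deg: "degree (P i j) \<le> n + m + 1 \<longleftrightarrow> degree (Q i j) \<le> n + 1" for i j
    using p p0 rot_inverse(3)[OF w] by (cases "Q i j = 0") (auto simp: P_def degree_mult_eq)
  have tr: "P 2 2 = - P 1 1 \<longleftrightarrow> Q 2 2 = - Q 1 1"
  proof -
    have "P 2 2 = - P 1 1 \<longleftrightarrow> p * Q 2 2 = p * - Q 1 1"
      by (simp add: P_def rot_def)
    also have "\<dots> \<longleftrightarrow> Q 2 2 = - Q 1 1"
      by (rule mult_left_cancel[OF p0(1)])
    finally show ?thesis .
  qed
  \<comment> \<open>Conjugation turns \<open>rot w i j\<close> into \<open>rot w j i\<close>, the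
    factor of the transposed entry. The degree bound permits reflecting \<open>p\<close> and
    \<open>Q i j\<close> separately.\<close>
  have st: "conj_reflect (n + m + 1) (P i j) = - P j i \<longleftrightarrow> conj_reflect (n + 1) (Q i j) = - Q j i"
    if "degree (Q i j) \<le> n + 1" for i j
  proof -
    have "conj_reflect (n + m + 1) (P i j) = smult (rot w j i) (p * conj_reflect (n + 1) (Q i j))"
      using conj_reflect_mult[of p m "Q i j" "n + 1"] p that
      by (simp add: P_def conj_reflect_smult cnj_rot add_ac)
    moreover have "- P j i = smult (rot w j i) (p * - Q j i)"
      by (simp add: P_def)
    ultimately show ?thesis
      by (simp only: smult_mult_left_cancel[OF rot_inverse(3)[OF w] p0(1)])
  qed
  have c12: "coeff (P 1 2) 0 = of_real c * coeff (Q 1 2) 0"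
    by (simp add: P_def rot_def coeff_mult_0 mult.assoc flip: wp(1))
  have r: "(\<exists>r>0. coeff (P 1 2) 0 = \<i> * of_real r) \<longleftrightarrow> (\<exists>r>0. coeff (Q 1 2) 0 = \<i> * of_real r)"
  proof
    assume "\<exists>r>0. coeff (P 1 2) 0 = \<i> * of_real r"
    then obtain r where "r > 0" "of_real c * coeff (Q 1 2) 0 = \<i> * of_real r"
      by (auto simp: c12)
    then show "\<exists>r>0. coeff (Q 1 2) 0 = \<i> * of_real r"
      using wp(2) by (intro exI[of _ "r / c"]) (simp add: field_simps)
  next
    assume "\<exists>r>0. coeff (Q 1 2) 0 = \<i> * of_real r"
    then obtain r where "r > 0" "coeff (Q 1 2) 0 = \<i> * of_real r" by blast
    then show "\<exists>r>0. coeff (P 1 2) 0 = \<i> * of_real r"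
      using wp(2) by (intro exI[of _ "c * r"]) (simp add: c12)
  qed
  have z: "coeff (P i j) 0 = 0 \<longleftrightarrow> coeff (Q i j) 0 = 0" for i j
    using p0 rot_inverse(3)[OF w] by (simp add: P_def coeff_mult_0)
  \<comment> \<open>Coefficient 1 of the product also contains coefficient 1 of \<open>p\<close>
    times coefficient 0 of \<open>Q 2 1\<close>, and the latter vanishes.\<close>
  have o: "coeff (P 2 1) 1 = 0 \<longleftrightarrow> coeff (Q 2 1) 1 = 0" if "coeff (Q 2 1) 0 = 0"
    using p0 rot_inverse(3)[OF w] that by (simp add: P_def coeff_mult atMost_Suc)
  have "potential_poly (n + m) P \<longleftrightarrow> potential_poly n Q"
    unfolding potential_poly_def deg tr r z
    \<comment> \<open>\<open>conj_cong\<close> makes earlier conjuncts available: the degree bound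
      for \<open>st\<close>, the vanishing coefficient for \<open>o\<close>.\<close>
    by (intro conj_cong refl) (simp_all only: st o not_False_eq_True)
  then show ?thesis by (simp add: P_def)
qed

text \<open>Common core of both cases: \<open>G\<close> multiplies by \<open>p\<close> and rotates,
  \<open>F\<close> divides by \<open>p\<close> and rotates back.\<close>

lemma diffeomorphic_isospectral_mult:
  fixes p b :: "complex poly"
  assumes p: "degree p = m" "conj_reflect m p = p" "coeff p 0 \<noteq> 0"
  shows "diffeomorphic {\<xi> \<in> isospectral (n + m) (p ^ 2 * b). \<forall>i j. p dvd entry (n + m) \<xi> i j}
    (isospectral n b)"
proof -
  let ?g = "n + m"
  \<comment> \<open>\<open>w\<close> is the phase opposite to that of p(0), so that w p(0) = |p(0)|
    > 0.\<close>
  define c where "c = norm (coeff p 0)"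
  define w where "w = cnj (coeff p 0) / of_real c"
  have c: "0 < c" using p by (simp add: c_def)
  have w: "norm w = 1" using c by (simp add: w_def norm_divide c_def)
  have wp: "w * coeff p 0 = of_real c"
  proof -
    have "w * coeff p 0 = of_real (c\<^sup>2) / of_real c"
      by (simp only: w_def c_def complex_norm_square times_divide_eq_right mult.commute)
    then show ?thesis using c by (simp add: power2_eq_square)
  qed
  note rot = rot_inverse[OF w]
  have p0: "p \<noteq> 0" using p by auto
  define F where "F = (\<lambda>\<xi>. family (\<lambda>i j. smult (rot (cnj w) i j) (entry ?g \<xi> i j div p)))"
  define G where "G = (\<lambda>\<eta>. family (\<lambda>i j. smult (rot w i j) (p * entry n \<eta> i j)))"
  note mult_iff = potential_poly_mult[OF p(1,2) w wp c]
  \<comment> \<open>The two off-diagonal rotation factors are inverse to each other, so only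
    \<open>p ^ 2\<close> survives in the determinant.\<close>
  have det: "smult (rot w 1 2) (p * Q 1 2) * smult (rot w 2 1) (p * Q 2 1) -
      smult (rot w 1 1) (p * Q 1 1) * smult (rot w 2 2) (p * Q 2 2) =
      p ^ 2 * (Q 1 2 * Q 2 1 - Q 1 1 * Q 2 2)" for Q :: "2 \<Rightarrow> 2 \<Rightarrow> complex poly"
  proof -
    have "rot w 1 2 * rot w 2 1 = 1" "rot w 1 1 = 1" "rot w 2 2 = 1"
      using rot(1)[of 1 2] by (auto simp: rot_def)
    then show ?thesis
      by (simp add: power2_eq_square algebra_simps)
  qed
  have G: "G \<eta> \<in> isospectral ?g (p ^ 2 * b)" "p dvd entry ?g (G \<eta>) i j" "F (G \<eta>) = \<eta>"
    if \<eta>: "\<eta> \<in> isospectral n b" for \<eta> i j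
  proof -
    let ?P = "\<lambda>i j. smult (rot w i j) (p * entry n \<eta> i j)"
    have supp: "\<forall>d. d \<notin> {-1..int n} \<longrightarrow> \<eta> d = 0"
      and pot: "potential_poly n (entry n \<eta>)"
      and d: "entry n \<eta> 1 2 * entry n \<eta> 2 1 - entry n \<eta> 1 1 * entry n \<eta> 2 2 = pCons 0 b"
      using \<eta> unfolding isospectral_iff by blast+
    have potP: "potential_poly ?g ?P" using pot by (simp only: mult_iff)
    then have deg: "degree (?P i j) \<le> ?g + 1" for i j
      by (rule potential_poly_degree)
    have e: "entry ?g (G \<eta>) = ?P"
      unfolding G_def by (intro ext entry_family deg)
    show "G \<eta> \<in> isospectral ?g (p ^ 2 * b)"
      unfolding isospectral_iff e det[of "entry n \<eta>"] d
      using potP family_supported[OF deg] by (simp add: G_def)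
    show "p dvd entry ?g (G \<eta>) i j" unfolding e by (intro dvd_smult dvd_triv_left)
    have "F (G \<eta>) = family (entry n \<eta>)"
      unfolding F_def e using p0 rot by (simp add: div_smult_left)
    then show "F (G \<eta>) = \<eta>" using family_entry[of n \<eta>] supp by simp
  qed
  have F: "F \<xi> \<in> isospectral n b" "G (F \<xi>) = \<xi>"
    if \<xi>: "\<xi> \<in> isospectral ?g (p ^ 2 * b)" and dvd: "\<And>i j. p dvd entry ?g \<xi> i j" for \<xi>
  proof -
    define Q where "Q = (\<lambda>i j. smult (rot (cnj w) i j) (entry ?g \<xi> i j div p))"
    have P: "entry ?g \<xi> = (\<lambda>i j. smult (rot w i j) (p * Q i j))"
      using dvd rot by (auto simp: Q_def intro!: ext)
    have supp: "\<forall>d. d \<notin> {-1..int ?g} \<longrightarrow> \<xi> d = 0"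
      and pot: "potential_poly ?g (entry ?g \<xi>)"
      and d: "entry ?g \<xi> 1 2 * entry ?g \<xi> 2 1 - entry ?g \<xi> 1 1 * entry ?g \<xi> 2 2 = pCons 0 (p ^ 2 * b)"
      using \<xi> unfolding isospectral_iff by blast+
    have potQ: "potential_poly n Q" using pot unfolding P by (simp only: mult_iff)
    then have deg: "degree (Q i j) \<le> n + 1" for i j
      by (rule potential_poly_degree)
    have e: "entry n (F \<xi>) = Q"
      unfolding F_def Q_def[symmetric] by (intro ext entry_family deg)
    have "p ^ 2 * (Q 1 2 * Q 2 1 - Q 1 1 * Q 2 2) = p ^ 2 * pCons 0 b"
      using d unfolding P det[of Q] by (simp only: mult_pCons_right smult_0_left add_0_left)
    moreover have "p ^ 2 \<noteq> 0" using p0 by simp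
    ultimately have "Q 1 2 * Q 2 1 - Q 1 1 * Q 2 2 = pCons 0 b"
      by (metis mult_left_cancel)
    then show "F \<xi> \<in> isospectral n b"
      unfolding isospectral_iff e
      using potQ family_supported[OF deg] by (simp add: F_def Q_def)
    have "G (F \<xi>) = family (entry ?g \<xi>)"
      unfolding G_def e by (simp add: P)
    then show "G (F \<xi>) = \<xi>" using family_entry[of ?g \<xi>] supp by simp
  qed
  show ?thesis
  proof (rule diffeomorphic_bounded_linear)
    \<comment> \<open>Over a field, \<open>div p\<close> is additive and commutes with scalars even
      on polynomials not divisible by \<open>p\<close>, so \<open>F\<close> is linear on the whole
      ambient space.\<close>
    show "bounded_linear F"
      unfolding F_def by (rule bounded_linear_family_entry)
        (simp_all add: poly_div_add_left smult_add_right div_smult_left mult.commute)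
    show "bounded_linear G"
      unfolding G_def by (rule bounded_linear_family_entry)
        (simp_all add: distrib_left smult_add_right mult.commute)
    fix \<xi>
    assume "\<xi> \<in> {\<xi> \<in> isospectral ?g (p ^ 2 * b). \<forall>i j. p dvd entry ?g \<xi> i j}"
    then have "\<xi> \<in> isospectral ?g (p ^ 2 * b)" "\<And>i j. p dvd entry ?g \<xi> i j"
      by blast+
    then show "F \<xi> \<in> isospectral n b" "G (F \<xi>) = \<xi>"
      by (rule F)+
  next
    fix \<eta> assume \<eta>: "\<eta> \<in> isospectral n b"
    show "G \<eta> \<in> {\<xi> \<in> isospectral ?g (p ^ 2 * b). \<forall>i j. p dvd entry ?g \<xi> i j}"
      using G(1,2)[OF \<eta>] by blast
    show "F (G \<eta>) = \<eta>" by (rule G(3)[OF \<eta>])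
  qed
qed

section \<open>Roots on the unit circle\<close>

text \<open>On the unit circle \<open>\<lambda>^((1 - g) / 2)\<close> times a potential is skew-Hermitian, and a
  skew-Hermitian traceless 2 by 2 matrix with determinant 0 vanishes.\<close>

lemma isospectral_root_on_circle:
  assumes \<xi>: "\<xi> \<in> isospectral g a" and \<alpha>: "norm \<alpha> = 1" "poly a \<alpha> = 0"
  shows "poly (entry g \<xi> i j) \<alpha> = 0"
proof -
  let ?X = "\<lambda>i j. poly (entry g \<xi> i j) \<alpha>"
  have pot: "potential_poly g (entry g \<xi>)"
    and d: "entry g \<xi> 1 2 * entry g \<xi> 2 1 - entry g \<xi> 1 1 * entry g \<xi> 2 2 = pCons 0 a"
    using \<xi> unfolding isospectral_iff by blast+
  have cc: "\<alpha> * cnj \<alpha> = 1"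
    using \<alpha> complex_norm_square[of \<alpha>] by simp
  then have \<alpha>1: "\<alpha> \<noteq> 0" by auto
  \<comment> \<open>The reflection z -> 1 / cnj z fixes the unit circle, so the reality condition
    relates values at \<alpha> itself.\<close>
  with cc have \<alpha>2: "1 / cnj \<alpha> = \<alpha>" by (simp add: divide_eq_eq)
  have st: "?X j i = - (\<alpha> ^ (g + 1) * cnj (?X i j))" for i j
  proof -
    have "poly (conj_reflect (g + 1) (entry g \<xi> i j)) \<alpha> = \<alpha> ^ (g + 1) * cnj (?X i j)"
      using poly_conj_reflect[OF degree_entry_le \<alpha>1] \<alpha>2 by simp
    moreover have "conj_reflect (g + 1) (entry g \<xi> i j) = - entry g \<xi> j i"
      using pot unfolding potential_poly_def by blast
    ultimately show ?thesis by (metis minus_equation_iff poly_minus)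
  qed
  have X22: "?X 2 2 = - ?X 1 1"
    using pot by (simp add: potential_poly_def)
  have "?X 1 2 * ?X 2 1 - ?X 1 1 * ?X 2 2 = 0"
    using arg_cong[OF d, of "\<lambda>q. poly q \<alpha>"] \<alpha> by simp
  then have "?X 1 2 * ?X 2 1 + ?X 1 1 * ?X 1 1 = 0"
    by (simp add: X22)
  \<comment> \<open>Replacing \<open>?X 2 1\<close> and one factor \<open>?X 1 1\<close> by reality
    turns the determinant into -\<alpha>^(g+1) times a sum of two squared norms.\<close>
  then have "?X 1 2 * (- (\<alpha> ^ (g + 1) * cnj (?X 1 2))) + ?X 1 1 * (- (\<alpha> ^ (g + 1) * cnj (?X 1 1))) = 0"
    by (metis st)
  then have "- (\<alpha> ^ (g + 1)) * (?X 1 2 * cnj (?X 1 2) + ?X 1 1 * cnj (?X 1 1)) = 0"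
    by (simp add: algebra_simps)
  then have "?X 1 2 * cnj (?X 1 2) + ?X 1 1 * cnj (?X 1 1) = 0"
    using \<alpha>1 by simp
  then have "complex_of_real ((norm (?X 1 2))\<^sup>2 + (norm (?X 1 1))\<^sup>2) = 0"
    by (simp only: complex_norm_square of_real_add)
  then have "(norm (?X 1 2))\<^sup>2 + (norm (?X 1 1))\<^sup>2 = 0"
    by (simp only: of_real_eq_0_iff)
  then have X0: "?X 1 2 = 0" "?X 1 1 = 0"
    by (auto simp: sum_power2_eq_zero_iff)
  then have "?X 2 1 = 0" using st[of 2 1] by simp
  with X0 X22 show ?thesis
    using exhaust_2[of i] exhaust_2[of j] by auto
qed

section \<open>Double roots and their reflections\<close>

lemma double_root_iff:
  assumes "a \<noteq> 0"
  shows "double_root a \<alpha> \<longleftrightarrow> [:- \<alpha>, 1:] ^ 2 dvd a"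
  using assms by (simp add: double_root_def order_divides)

lemma conj_reflect_spectral:
  assumes "a \<in> spectral_polys g"
  shows "conj_reflect (2 * g) a = a"
  by (rule poly_eqI_nonzero) (use assms in \<open>auto simp: spectral_polys_def poly_conj_reflect\<close>)

text \<open>The roots \<alpha> and 1 / cnj \<alpha> differ off the circle: a linear combination of
  the two factors is the nonzero constant 1 - |\<alpha>|^2.\<close>

lemma coprime_reflected_linear:
  assumes "\<alpha> \<noteq> 0" "norm \<alpha> \<noteq> 1"
  shows "coprime [:- \<alpha>, 1:] [:1, - cnj \<alpha>:]"
proof (rule coprimeI)
  fix d :: "complex poly" assume d: "d dvd [:- \<alpha>, 1:]" "d dvd [:1, - cnj \<alpha>:]"
  have "d dvd smult (cnj \<alpha>) [:- \<alpha>, 1:] + [:1, - cnj \<alpha>:]"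
    using d by (intro dvd_add dvd_smult)
  also have "smult (cnj \<alpha>) [:- \<alpha>, 1:] + [:1, - cnj \<alpha>:] = [:1 - \<alpha> * cnj \<alpha>:]"
    by simp
  finally have "d dvd [:1 - \<alpha> * cnj \<alpha>:]" .
  moreover have "1 - \<alpha> * cnj \<alpha> \<noteq> 0"
  proof
    assume "1 - \<alpha> * cnj \<alpha> = 0"
    then have "\<alpha> * cnj \<alpha> = 1" by simp
    then have "complex_of_real ((norm \<alpha>)\<^sup>2) = complex_of_real 1"
      by (simp only: complex_norm_square of_real_1)
    then have "(norm \<alpha>)\<^sup>2 = 1" by (simp only: of_real_eq_iff)
    then have "norm \<alpha> = 1"
      using norm_ge_zero[of \<alpha>] by (auto simp: power2_eq_1_iff simp del: norm_ge_zero)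
    then show False using assms(2) by simp
  qed
  then have "is_unit [:1 - \<alpha> * cnj \<alpha>:]"
    by (simp add: is_unit_pCons_iff)
  ultimately show "is_unit d" by (rule dvd_trans)
qed

lemma conj_reflect_linear_square: "conj_reflect 2 ([:- \<alpha>, 1:] ^ 2) = [:1, - cnj \<alpha>:] ^ 2"
  using conj_reflect_mult[of "[:- \<alpha>, 1:]" 1 "[:- \<alpha>, 1:]" 1]
  by (simp add: power2_eq_square conj_reflect_linear[unfolded One_nat_def] numeral_2_eq_2)

text \<open>Since \<open>a\<close> is self-reflected, its factor (\<lambda> - \<alpha>)^2 reflects
  to another factor of \<open>a\<close>; coprimality combines the two.\<close>

lemma spectral_reflected_double_root:
  assumes a: "a \<in> spectral_polys g" and \<alpha>: "\<alpha> \<noteq> 0" "norm \<alpha> \<noteq> 1" "double_root a \<alpha>"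
  shows "[:- \<alpha>, 1:] ^ 2 * [:1, - cnj \<alpha>:] ^ 2 dvd a"
proof -
  have a0: "a \<noteq> 0" using a by (auto simp: spectral_polys_def)
  obtain b where b: "a = [:- \<alpha>, 1:] ^ 2 * b"
    using \<alpha>(3) a0 by (auto simp: double_root_iff)
  then have b0: "b \<noteq> 0" using a0 by auto
  have "degree a = 2 + degree b"
    unfolding b using b0 by (simp add: degree_mult_eq degree_power_eq)
  then have deg: "2 + degree b \<le> 2 * g"
    using a by (simp add: spectral_polys_def)
  \<comment> \<open>The degree bound makes the truncated subtraction exact, so reflection of order 2
    g splits into orders 2 and 2 g - 2.\<close>
  then have "2 + (2 * g - 2) = 2 * g" by simp
  then have "a = conj_reflect (2 + (2 * g - 2)) a"
    using conj_reflect_spectral[OF a] by metis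
  also have "\<dots> = conj_reflect 2 ([:- \<alpha>, 1:] ^ 2) * conj_reflect (2 * g - 2) b"
    unfolding b by (rule conj_reflect_mult) (use deg in \<open>simp_all add: degree_power_eq\<close>)
  finally have "[:1, - cnj \<alpha>:] ^ 2 dvd a"
    unfolding conj_reflect_linear_square by (metis dvd_triv_left)
  then show ?thesis
    using b coprime_reflected_linear[OF \<alpha>(1,2)] by (intro divides_mult) auto
qed

text \<open>Reality carries a common zero of all entries at \<alpha> to one at 1 / cnj \<alpha>,
  with indices transposed. Vanishing at \<alpha> alone thus gives divisibility by both coprime
  factors.\<close>

lemma laurent_eval_eq_0_iff_dvd:
  assumes \<xi>: "\<xi> \<in> isospectral g a" and \<alpha>: "\<alpha> \<noteq> 0" "norm \<alpha> \<noteq> 1"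
  shows "laurent_eval g \<xi> \<alpha> = 0 \<longleftrightarrow>
    (\<forall>i j. [:- \<alpha>, 1:] * [:1, - cnj \<alpha>:] dvd entry g \<xi> i j)"
proof
  assume "laurent_eval g \<xi> \<alpha> = 0"
  then have z: "poly (entry g \<xi> i j) \<alpha> = 0" for i j
    using \<alpha> by (simp add: poly_entry)
  show "\<forall>i j. [:- \<alpha>, 1:] * [:1, - cnj \<alpha>:] dvd entry g \<xi> i j"
  proof (intro allI)
    fix i j
    have st: "conj_reflect (g + 1) (entry g \<xi> j i) = - entry g \<xi> i j"
      using \<xi> unfolding isospectral_iff potential_poly_def by blast
    have "poly (conj_reflect (g + 1) (entry g \<xi> j i)) (1 / cnj \<alpha>) = 0"
      using \<alpha> poly_conj_reflect[OF degree_entry_le, of "1 / cnj \<alpha>" g \<xi> j i] z by simp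
    then have "poly (entry g \<xi> i j) (1 / cnj \<alpha>) = 0"
      unfolding st by simp
    then have "[:- (1 / cnj \<alpha>), 1:] dvd entry g \<xi> i j"
      by (simp only: poly_eq_0_iff_dvd)
    moreover have "[:1, - cnj \<alpha>:] = smult (- cnj \<alpha>) [:- (1 / cnj \<alpha>), 1:]"
      using \<alpha> by simp
    ultimately have "[:1, - cnj \<alpha>:] dvd entry g \<xi> i j"
      using \<alpha> by (simp add: smult_dvd_iff del: smult_pCons)
    moreover have "[:- \<alpha>, 1:] dvd entry g \<xi> i j"
      using z by (simp add: poly_eq_0_iff_dvd)
    ultimately show "[:- \<alpha>, 1:] * [:1, - cnj \<alpha>:] dvd entry g \<xi> i j"
      using coprime_reflected_linear[OF \<alpha>] by (intro divides_mult)
  qed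
next
  assume "\<forall>i j. [:- \<alpha>, 1:] * [:1, - cnj \<alpha>:] dvd entry g \<xi> i j"
  then have "poly (entry g \<xi> i j) \<alpha> = 0" for i j
    using dvd_mult_left poly_eq_0_iff_dvd by blast
  then show "laurent_eval g \<xi> \<alpha> = 0"
    using \<alpha> by (simp add: poly_entry vec_eq_iff)
qed

section \<open>The two diffeomorphisms\<close>

lemma diffeomorphic_isospectral_circle:
  assumes "1 \<le> g" and a: "a \<in> spectral_polys g" and \<alpha>: "norm \<alpha> = 1" "double_root a \<alpha>"
  shows "diffeomorphic (isospectral g a)
    (isospectral (g - 1) (smult (- \<alpha>) (a div [:- \<alpha>, 1:] ^ 2)))"
proof -
  define l where "l = [:- \<alpha>, 1:]"
  let ?b = "smult (- \<alpha>) (a div l ^ 2)"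
  \<comment> \<open>The constant -cnj \<alpha> in \<open>p ^ 2\<close> cancels the factor -\<alpha>
    of \<open>?b\<close>, so that \<open>p ^ 2 * ?b = a\<close>.\<close>
  define c where "c = csqrt (- cnj \<alpha>)"
  define p where "p = smult c l"
  have \<alpha>1: "\<alpha> * cnj \<alpha> = 1" using \<alpha> complex_norm_square[of \<alpha>] by simp
  have c2: "c * c = - cnj \<alpha>"
    unfolding c_def by (metis power2_csqrt power2_eq_square)
  have "(norm c)\<^sup>2 = norm (c * c)"
    by (simp add: norm_mult power2_eq_square)
  also have "\<dots> = 1"
    unfolding c2 using \<alpha> by simp
  finally have cc: "c * cnj c = 1"
    by (simp only: complex_norm_square[symmetric] of_real_1)
  have c0: "c \<noteq> 0" "\<alpha> \<noteq> 0" using cc \<alpha>1 by auto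
  \<comment> \<open>As |c| = 1, the inverse of \<open>c\<close> is \<open>cnj c\<close>. The
    resulting relation says that conjugation swaps the two coefficients of \<open>p\<close>, which
    is self-reflection of order 1.\<close>
  have "c * - (c * \<alpha>) = - (c * c) * \<alpha>"
    by simp
  also have "\<dots> = c * cnj c"
    unfolding c2 cc using \<alpha>1 by (simp add: mult.commute)
  finally have cb: "cnj c = - (c * \<alpha>)"
    using c0(1) mult_left_cancel by metis
  have a0: "a \<noteq> 0" using a by (auto simp: spectral_polys_def)
  have dvd: "l ^ 2 dvd a" using \<alpha>(2) a0 by (simp add: double_root_iff l_def)
  have "p ^ 2 * ?b = smult (c * c * - \<alpha>) (l ^ 2 * (a div l ^ 2))"
    by (simp add: p_def power2_eq_square mult_ac)
  also have "c * c * - \<alpha> = 1"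
    unfolding c2 using \<alpha>1 by (simp add: mult.commute)
  finally have pb: "p ^ 2 * ?b = a"
    using dvd by simp
  have "l dvd a"
    using dvd unfolding power2_eq_square by (rule dvd_mult_left)
  then have root: "poly a \<alpha> = 0"
    by (simp only: l_def poly_eq_0_iff_dvd)
  \<comment> \<open>All entries vanish at the root \<alpha>, so divisibility by the linear
    \<open>p\<close> excludes no element of \<open>isospectral g a\<close>.\<close>
  have pdvd: "p dvd entry g \<xi> i j" if "\<xi> \<in> isospectral g a" for \<xi> i j
    using isospectral_root_on_circle[OF that \<alpha>(1) root] c0
    by (simp add: p_def l_def smult_dvd_iff poly_eq_0_iff_dvd del: smult_pCons)
  have cbb: "cnj (- (c * \<alpha>)) = c" by (simp flip: cb)
  have "conj_reflect 1 p = p"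
    using conj_reflect_linear[of "- (c * \<alpha>)" c] by (simp add: p_def l_def cb cbb \<alpha>1)
  moreover have "degree p = 1" "coeff p 0 \<noteq> 0"
    using c0 by (simp_all add: p_def l_def)
  ultimately have "diffeomorphic
      {\<xi> \<in> isospectral (g - 1 + 1) (p ^ 2 * ?b). \<forall>i j. p dvd entry (g - 1 + 1) \<xi> i j}
      (isospectral (g - 1) ?b)"
    by (intro diffeomorphic_isospectral_mult)
  moreover have "{\<xi> \<in> isospectral g a. \<forall>i j. p dvd entry g \<xi> i j} = isospectral g a"
    using pdvd by auto
  ultimately show ?thesis
    unfolding pb using assms(1) by (simp add: l_def)
qed

lemma diffeomorphic_isospectral_off_circle:
  assumes a: "a \<in> spectral_polys g" and \<alpha>: "\<alpha> \<noteq> 0" "norm \<alpha> \<noteq> 1" "double_root a \<alpha>"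
  shows "diffeomorphic {\<xi> \<in> isospectral g a. laurent_eval g \<xi> \<alpha> = 0}
    (isospectral (g - 2) (a div ([:- \<alpha>, 1:] ^ 2 * [:1, - cnj \<alpha>:] ^ 2)))"
proof -
  define p where "p = [:- \<alpha>, 1:] * [:1, - cnj \<alpha>:]"
  have p2: "p ^ 2 = [:- \<alpha>, 1:] ^ 2 * [:1, - cnj \<alpha>:] ^ 2"
    unfolding p_def by (rule power_mult_distrib)
  have dvd: "p ^ 2 dvd a"
    unfolding p2 by (rule spectral_reflected_double_root[OF a \<alpha>])
  have deg: "degree p = 2" using \<alpha> by (simp add: p_def)
  then have "p \<noteq> 0" by auto
  have "a \<noteq> 0" using a by (auto simp: spectral_polys_def)
  \<comment> \<open>A divisor of degree 4 forces g to be at least 2, so \<open>g - 2\<close> is a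
    genuine subtraction.\<close>
  then have "4 \<le> degree a"
    using dvd_imp_degree_le[OF dvd] \<open>p \<noteq> 0\<close> deg by (simp add: degree_power_eq)
  then have g: "g - 2 + 2 = g"
    using a by (auto simp: spectral_polys_def)
  \<comment> \<open>Reflection exchanges the two linear factors, so their product is self-reflected
    without a normalising constant.\<close>
  have "conj_reflect 2 p = conj_reflect 1 [:- \<alpha>, 1:] * conj_reflect 1 [:1, - cnj \<alpha>:]"
    unfolding p_def using conj_reflect_mult[of "[:- \<alpha>, 1:]" 1 "[:1, - cnj \<alpha>:]" 1]
    by (simp only: one_add_one) simp
  also have "\<dots> = p"
    unfolding conj_reflect_linear p_def by simp
  finally have "conj_reflect 2 p = p" .
  moreover have "coeff p 0 \<noteq> 0" using \<alpha> by (simp add: p_def)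
  ultimately have "diffeomorphic
      {\<xi> \<in> isospectral (g - 2 + 2) (p ^ 2 * (a div p ^ 2)). \<forall>i j. p dvd entry (g - 2 + 2) \<xi> i j}
      (isospectral (g - 2) (a div p ^ 2))"
    using deg by (intro diffeomorphic_isospectral_mult)
  moreover have "{\<xi> \<in> isospectral g a. \<forall>i j. p dvd entry g \<xi> i j} =
      {\<xi> \<in> isospectral g a. laurent_eval g \<xi> \<alpha> = 0}"
    using laurent_eval_eq_0_iff_dvd[OF _ \<alpha>(1,2)] by (auto simp: p_def)
  ultimately show ?thesis
    unfolding g p2[symmetric] using dvd by simp
qed

theorem lemma4p7:
  fixes g :: nat and a :: "complex poly"
  assumes "1 \<le> g" and "a \<in> spectral_polys g"
  shows "(\<forall>\<alpha>. norm \<alpha> = 1 \<and> double_root a \<alpha> \<longrightarrow>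
            diffeomorphic (isospectral g a)
              (isospectral (g - 1) (smult (- \<alpha>) (a div [:- \<alpha>, 1:] ^ 2)))) \<and>
         (\<forall>\<alpha>. \<alpha> \<noteq> 0 \<and> norm \<alpha> \<noteq> 1 \<and> double_root a \<alpha> \<longrightarrow>
            isospectral g a =
              {\<xi> \<in> isospectral g a. laurent_eval g \<xi> \<alpha> \<noteq> 0} \<union>
              {\<xi> \<in> isospectral g a. laurent_eval g \<xi> \<alpha> = 0} \<and>
            diffeomorphic {\<xi> \<in> isospectral g a. laurent_eval g \<xi> \<alpha> = 0}
              (isospectral (g - 2) (a div ([:- \<alpha>, 1:] ^ 2 * [:1, - cnj \<alpha>:] ^ 2))))"
  using diffeomorphic_isospectral_circle[OF assms] diffeomorphic_isospectral_off_circle[OF assms(2)]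
  by auto

end
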